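(* Let $\mathcal{S}=(\mathbf{G},\mathbf{I},\boldsymbol{\lambda},\boldsymbol{\rho})$ be a $\lambda\rho$-system, with $\mathbf{G}$ a semigroup. Then the following are equivalent: (1) $\mathcal{S}$ is group-preserving, that is, $\mathbf{H}^{[\mathcal{S}]}$ is a group for every group $\mathbf{H}$; (2) $\mathbf{G}$ is a group and $\mathcal{S}$ is unital; (3) $\mathbf{G}$ is a group and $\mathcal{S}\cong\mathcal{S}(X,\mathbf{G})$ for some set $X$ on which $\mathbf{G}$ acts.
   Context: Composition convention: $(g\circ f)(x)=g(f(x))$. A $\lambda\rho$-system $(\mathbf{S},\mathbf{I},\boldsymbol{\lambda},\boldsymbol{\rho})$ consists of a semigroup $\mathbf{S}$ with universe $S$, sets $(I[s])_{s\in S}$ (possibly empty), and maps $\lambda[a,b]\colon I[ab]\to I[a]$, $\rho[a,b]\colon I[ab]\to I[b]$ for $a,b\in S$, such that for all $a,b,c\in S$: ($\alpha$) $\lambda[a,b]\circ\lambda[ab,c]=\lambda[a,bc]$; ($\beta$) $\rho[b,c]\circ\rho[a,bc]=\rho[ab,c]$; ($\gamma$) $\rho[a,b]\circ\lambda[ab,c]=\lambda[b,c]\circ\rho[a,bc]$. For a semigroup $\mathbf{H}$, the $\lambda\rho$-product $\mathbf{H}^{[\mathcal{S}]}$ is the semigroup with universe $\{(x,a)\colon a\in S,\ x\in H^{I[a]}\}$ and operation $(x,a)\star(y,b)=\bigl((x\circ\lambda[a,b])\cdot(y\circ\rho[a,b]),\,ab\bigr)$, where $\cdot$ is the pointwise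 product. The system is unital if $\mathbf{S}$ is a monoid (with unit $1$) and $\lambda[a,1]$ and $\rho[1,a]$ are the identity map on $I[a]$ for each $a\in S$. For a group $\mathbf{G}$ acting on a set $X$, with the action written $x\cdot a$ and satisfying $(x\cdot a)\cdot b=x\cdot(ab)$ and $x\cdot e=x$ ($e$ the unit of $\mathbf{G}$), $\mathcal{S}(X,\mathbf{G})$ is the $\lambda\rho$-system over $\mathbf{G}$ with $I[s]=X$ for all $s\in G$, $\lambda[a,b]=\mathrm{id}_X$, and $\rho[a,b]\colon X\to X$, $x\mapsto x\cdot a$, for all $a,b\in G$. (The $\lambda\rho$-product $\mathbf{H}^{[\mathcal{S}(X,\mathbf{G})]}$ is then the wreath product of $\mathbf{H}$ with $(X,\mathbf{G})$.) Isomorphism $\cong$ is isomorphism in the category of $\lambda\rho$-systems whose morphisms are transformations: a transformation $\mathcal{S}'\to\mathcal{S}$ between $\mathcal{S}'=(\mathbf{S}',\mathbf{I}',\boldsymbol{\lambda}',\boldsymbol{\rho}')$ and $\mathcal{S}=(\mathbf{S},\mathbf{I},\boldsymbol{\lambda},\boldsymbol{\rho})$ is a pair $(t,h)$ with $h\colon\mathbf{S}\to\mathbf{S}'$ a semigroup homomorphism and $t=(t[a]\colon I'[h(a)]\to I[a])_{a\in S}$ maps such that $\lambda[a,b]\circ t[ab]=t[a]\circ\lambda'[h(a),h(b)]$ and $\rho[a,b]\circ t[ab]=t[b]\circ\rho'[h(a),h(b)]$ for all $a,b\in S$. So an isomorphism is a transformation with $h$ an isomorphism and all $t[a]$ bijections.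 *)

theory Defs
  imports "HOL-Algebra.Group"
begin

(* HOL-Algebra has no semigroups: its monoid record carries a unit as structure.
   Semigroups therefore get their own record, and "being a monoid" or "being a group" is
   the property that some unit makes the semigroup into one in the sense of HOL-Algebra.
   An empty carrier is allowed. *)

record 'a semigrp = "'a partial_object" +
  sop :: "'a \<Rightarrow> 'a \<Rightarrow> 'a"

definition is_semigroup :: "'a semigrp \<Rightarrow> bool" where
  "is_semigroup M \<longleftrightarrow>
     (\<forall>a\<in>carrier M. \<forall>b\<in>carrier M. sop M a b \<in> carrier M) \<and>
     (\<forall>a\<in>carrier M. \<forall>b\<in>carrier M. \<forall>c\<in>carrier M.
        sop M (sop M a b) c = sop M a (sop M b c))"

definition with_unit :: "'a semigrp \<Rightarrow> 'a \<Rightarrow> 'a monoid" where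
  "with_unit M e = \<lparr>carrier = carrier M, mult = sop M, one = e\<rparr>"

definition is_group :: "'a semigrp \<Rightarrow> bool" where
  "is_group M \<longleftrightarrow> (\<exists>e. group (with_unit M e))"

(* Composition is the usual right-to-left one, (g o f)(x) = g(f(x)).  All sets I[a] live in
   one type 'i; they need not be disjoint, and values of the structure maps
   outside the stated domains are irrelevant. *)

record ('a, 'i) lr_data =
  base :: "'a semigrp"
  idx :: "'a \<Rightarrow> 'i set"
  lam :: "'a \<Rightarrow> 'a \<Rightarrow> 'i \<Rightarrow> 'i"
  rho :: "'a \<Rightarrow> 'a \<Rightarrow> 'i \<Rightarrow> 'i"

locale lr_system =
  fixes S :: "('a, 'i) lr_data"
  assumes base_semigroup: "is_semigroup (base S)"
    and lam_maps: "\<lbrakk>a \<in> carrier (base S); b \<in> carrier (base S)\<rbrakk>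
      \<Longrightarrow> lam S a b \<in> idx S (sop (base S) a b) \<rightarrow> idx S a"
    and rho_maps: "\<lbrakk>a \<in> carrier (base S); b \<in> carrier (base S)\<rbrakk>
      \<Longrightarrow> rho S a b \<in> idx S (sop (base S) a b) \<rightarrow> idx S b"
    and alpha: "\<lbrakk>a \<in> carrier (base S); b \<in> carrier (base S); c \<in> carrier (base S);
        i \<in> idx S (sop (base S) (sop (base S) a b) c)\<rbrakk>
      \<Longrightarrow> lam S a b (lam S (sop (base S) a b) c i) = lam S a (sop (base S) b c) i"
    and beta: "\<lbrakk>a \<in> carrier (base S); b \<in> carrier (base S); c \<in> carrier (base S);
        i \<in> idx S (sop (base S) (sop (base S) a b) c)\<rbrakk>
      \<Longrightarrow> rho S b c (rho S a (sop (base S) b c) i) = rho S (sop (base S) a b) c i"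
    and gamma: "\<lbrakk>a \<in> carrier (base S); b \<in> carrier (base S); c \<in> carrier (base S);
        i \<in> idx S (sop (base S) (sop (base S) a b) c)\<rbrakk>
      \<Longrightarrow> rho S a b (lam S (sop (base S) a b) c i) = lam S b c (rho S a (sop (base S) b c) i)"

(* The power of H indexed by I[a] is the extensional function space. *)

definition lr_product :: "'h semigrp \<Rightarrow> ('a, 'i) lr_data \<Rightarrow> (('i \<Rightarrow> 'h) \<times> 'a) semigrp" where
  "lr_product H S =
     \<lparr>carrier = {(x, a). a \<in> carrier (base S) \<and> x \<in> idx S a \<rightarrow>\<^sub>E carrier H},
      sop = (\<lambda>(x, a) (y, b).
        (\<lambda>i\<in>idx S (sop (base S) a b). sop H (x (lam S a b i)) (y (rho S a b i)),
         sop (base S) a b))\<rparr>"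

(* HOL cannot quantify over types inside a formula, so "every group H" ranges over all groups
   whose carrier is a subset of a type 'h, given by the first argument.  On a one-element
   type only trivial groups exist and the notion says nothing about the index sets; on a type
   with at least two elements there are a two-element group and a trivial one.  Results about
   this predicate should be stated for all types 'h with at least two elements: the types are
   then arbitrarily large, and every group is isomorphic to one on a subset of such a type. *)

definition group_preserving :: "'h itself \<Rightarrow> ('a, 'i) lr_data \<Rightarrow> bool" where
  "group_preserving _ S \<longleftrightarrow> (\<forall>H :: 'h semigrp. is_group H \<longrightarrow> is_group (lr_product H S))"

definition unital :: "('a, 'i) lr_data \<Rightarrow> bool" where
  "unital S \<longleftrightarrow>
     (\<exists>e. monoid (with_unit (base S) e) \<and>
        (\<forall>a\<in>carrier (base S). \<forall>i\<in>idx S a. lam S a e i = i \<and> rho S e a i = i))"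

definition right_action :: "'a semigrp \<Rightarrow> 'i set \<Rightarrow> ('i \<Rightarrow> 'a \<Rightarrow> 'i) \<Rightarrow> bool" where
  "right_action G X act \<longleftrightarrow>
     (\<exists>e. group (with_unit G e) \<and>
        (\<forall>x\<in>X. \<forall>a\<in>carrier G. act x a \<in> X) \<and>
        (\<forall>x\<in>X. \<forall>a\<in>carrier G. \<forall>b\<in>carrier G. act (act x a) b = act x (sop G a b)) \<and>
        (\<forall>x\<in>X. act x e = x))"

definition action_system :: "'i set \<Rightarrow> ('i \<Rightarrow> 'a \<Rightarrow> 'i) \<Rightarrow> 'a semigrp \<Rightarrow> ('a, 'i) lr_data" where
  "action_system X act G =
     \<lparr>base = G, idx = (\<lambda>s. X), lam = (\<lambda>a b x. x), rho = (\<lambda>a b x. act x a)\<rparr>"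

(* A transformation from S' to S: the homomorphism h goes backwards, from the
   base of S to the base of S'. *)

definition transformation ::
  "('b, 'j) lr_data \<Rightarrow> ('a, 'i) lr_data \<Rightarrow> ('a \<Rightarrow> 'j \<Rightarrow> 'i) \<Rightarrow> ('a \<Rightarrow> 'b) \<Rightarrow> bool" where
  "transformation S' S t h \<longleftrightarrow>
     h \<in> carrier (base S) \<rightarrow> carrier (base S') \<and>
     (\<forall>a\<in>carrier (base S). \<forall>b\<in>carrier (base S).
        h (sop (base S) a b) = sop (base S') (h a) (h b)) \<and>
     (\<forall>a\<in>carrier (base S). t a \<in> idx S' (h a) \<rightarrow> idx S a) \<and>
     (\<forall>a\<in>carrier (base S). \<forall>b\<in>carrier (base S). \<forall>i\<in>idx S' (h (sop (base S) a b)).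
        lam S a b (t (sop (base S) a b) i) = t a (lam S' (h a) (h b) i) \<and>
        rho S a b (t (sop (base S) a b) i) = t b (rho S' (h a) (h b) i))"

definition lr_iso :: "('b, 'j) lr_data \<Rightarrow> ('a, 'i) lr_data \<Rightarrow> bool" where
  "lr_iso S' S \<longleftrightarrow>
     (\<exists>t h. transformation S' S t h \<and>
        bij_betw h (carrier (base S)) (carrier (base S')) \<and>
        (\<forall>a\<in>carrier (base S). bij_betw (t a) (idx S' (h a)) (idx S a)))"

lemma lr_system_action_system:
  assumes "right_action G X act"
  shows "lr_system (action_system X act G)"
proof -
  obtain e where e: "group (with_unit G e)"
    using assms by (auto simp: right_action_def)
  interpret group "with_unit G e" by (fact e)
  have "is_semigroup G"
    using m_closed m_assoc by (auto simp: is_semigroup_def with_unit_def)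
  then show ?thesis
    using assms by unfold_locales (auto simp: action_system_def right_action_def)
qed

lemma (in lr_system) is_semigroup_lr_product:
  assumes "is_semigroup H"
  shows "is_semigroup (lr_product H S)"
proof -
  have cl: "sop (base S) a b \<in> carrier (base S)"
    if "a \<in> carrier (base S)" "b \<in> carrier (base S)" for a b
    using base_semigroup that by (auto simp: is_semigroup_def)
  have as: "sop (base S) (sop (base S) a b) c = sop (base S) a (sop (base S) b c)"
    if "a \<in> carrier (base S)" "b \<in> carrier (base S)" "c \<in> carrier (base S)" for a b c
    using base_semigroup that by (auto simp: is_semigroup_def)
  have lamI: "lam S a b i \<in> idx S a" and rhoI: "rho S a b i \<in> idx S b"
    if "a \<in> carrier (base S)" "b \<in> carrier (base S)" "i \<in> idx S (sop (base S) a b)" for a b i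
    using lam_maps[of a b] rho_maps[of a b] that by auto
  have clH: "sop H p q \<in> carrier H" if "p \<in> carrier H" "q \<in> carrier H" for p q
    using assms that by (auto simp: is_semigroup_def)
  have asH: "sop H (sop H p q) r = sop H p (sop H q r)"
    if "p \<in> carrier H" "q \<in> carrier H" "r \<in> carrier H" for p q r
    using assms that by (auto simp: is_semigroup_def)
  show ?thesis
    unfolding is_semigroup_def
  proof (intro conjI ballI)
    fix u v assume "u \<in> carrier (lr_product H S)" "v \<in> carrier (lr_product H S)"
    then show "sop (lr_product H S) u v \<in> carrier (lr_product H S)"
      by (auto simp: lr_product_def cl PiE_iff intro!: clH lamI rhoI)
  next
    fix u v w
    assume "u \<in> carrier (lr_product H S)" "v \<in> carrier (lr_product H S)"
      "w \<in> carrier (lr_product H S)"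
    then obtain x a y b z c where uvw: "u = (x, a)" "v = (y, b)" "w = (z, c)"
      and abc: "a \<in> carrier (base S)" "b \<in> carrier (base S)" "c \<in> carrier (base S)"
      and xyz: "x \<in> idx S a \<rightarrow>\<^sub>E carrier H" "y \<in> idx S b \<rightarrow>\<^sub>E carrier H"
        "z \<in> idx S c \<rightarrow>\<^sub>E carrier H"
      by (auto simp: lr_product_def)
    have "sop H (sop H (x (lam S a b (lam S (sop (base S) a b) c i)))
              (y (rho S a b (lam S (sop (base S) a b) c i)))) (z (rho S (sop (base S) a b) c i))
        = sop H (x (lam S a (sop (base S) b c) i))
            (sop H (y (lam S b c (rho S a (sop (base S) b c) i)))
              (z (rho S b c (rho S a (sop (base S) b c) i))))"
      (is "?l = ?r")
      if i: "i \<in> idx S (sop (base S) a (sop (base S) b c))" for i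
    proof -
      have i': "i \<in> idx S (sop (base S) (sop (base S) a b) c)"
        using i abc by (simp add: as)
      have "x (lam S a (sop (base S) b c) i) \<in> carrier H"
        using xyz(1) lamI[OF abc(1) cl[OF abc(2,3)] i] by auto
      moreover have r: "rho S a (sop (base S) b c) i \<in> idx S (sop (base S) b c)"
        using rhoI[OF abc(1) cl[OF abc(2,3)] i] .
      moreover have "y (lam S b c (rho S a (sop (base S) b c) i)) \<in> carrier H"
        using xyz(2) lamI[OF abc(2,3) r] by auto
      moreover have "z (rho S b c (rho S a (sop (base S) b c) i)) \<in> carrier H"
        using xyz(3) rhoI[OF abc(2,3) r] by auto
      ultimately show ?thesis
        using alpha[OF abc i'] beta[OF abc i'] gamma[OF abc i'] by (simp add: asH)
    qed
    then show "sop (lr_product H S) (sop (lr_product H S) u v) w =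
        sop (lr_product H S) u (sop (lr_product H S) v w)"
      using abc by (auto simp: lr_product_def uvw as lamI rhoI cl intro!: restrict_ext)
  qed
qed

end

theory Submission
  imports Defs
begin

text \<open>
  (1) implies (2): the product projects onto the base, which is therefore a group.
  With \<open>H\<close> of order two, the product has a unit \<open>(u, e)\<close>; multiplying it with the constant
  function \<open>1\<close> shows that \<open>u\<close> is \<open>1\<close> on the ranges of \<open>\<lambda>[e,a]\<close> and \<open>\<rho>[a,e]\<close>. Hence composition with
  \<open>\<rho>[e,a]\<close> or \<open>\<lambda>[a,e]\<close> fixes every \<open>H\<close>-valued function on \<open>I[a]\<close>, and these functions
  separate points.

  (2) implies (1) and (3): over a group, unitality and (\<open>\<alpha>\<close>) make every \<open>\<lambda>[a,b]\<close> bijective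
  with inverse \<open>\<lambda>[ab,b\<inverse>]\<close>. So inverses can be solved for in the product, and the maps
  \<open>\<lambda>[e,a]\<close> identify all \<open>I[a]\<close> with \<open>X = I[e]\<close>, turning \<open>\<rho>\<close> into an action of the group.

  (3) implies (2): an isomorphism transports the identities \<open>\<lambda>[a,e] = id\<close> and \<open>\<rho>[e,a] = id\<close>.
\<close>

section \<open>Units of semigroups and the group of order two\<close>

lemma with_unit_simps [simp]:
  "carrier (with_unit M e) = carrier M" "mult (with_unit M e) = sop M" "one (with_unit M e) = e"
  by (simp_all add: with_unit_def)

lemma with_unit_one_unique:
  assumes "monoid (with_unit M e)" "monoid (with_unit M e')"
  shows "e = e'"
proof -
  have "sop M e e' = e'" "sop M e e' = e"
    using monoid.l_one[OF assms(1), of e'] monoid.one_closed[OF assms(2)]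
      monoid.r_one[OF assms(2), of e] monoid.one_closed[OF assms(1)] by simp_all
  then show ?thesis by simp
qed

text \<open>The group of order two, written on any two distinct elements of a type, so that it
  exists inside every admissible \<open>'h\<close>.\<close>

lemma group_two_elements:
  assumes "p \<noteq> q"
  shows "group (with_unit \<lparr>carrier = {p, q}, sop = \<lambda>x y. if x = y then p else q\<rparr> p)"
  using assms by (intro groupI) auto

section \<open>What a unit or inverses in the product say about the system\<close>

lemma carrier_lr_product [simp]:
  "carrier (lr_product H S) = {(x, a). a \<in> carrier (base S) \<and> x \<in> idx S a \<rightarrow>\<^sub>E carrier H}"
  by (simp add: lr_product_def)

lemma sop_lr_product [simp]:
  "sop (lr_product H S) (x, a) (y, b) =
    (\<lambda>i\<in>idx S (sop (base S) a b). sop H (x (lam S a b i)) (y (rho S a b i)), sop (base S) a b)"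
  by (simp add: lr_product_def)

text \<open>Over each base element lies the constant function \<open>p\<close>, so the left unit law
  and left inverses can be read off from second components.\<close>

lemma base_group_of_lr_product_group:
  assumes "lr_system S" and H: "p \<in> carrier H"
    and P: "group (with_unit (lr_product H S) (u, e))"
  shows "group (with_unit (base S) e)"
proof -
  interpret lr_system S by fact
  interpret P: group "with_unit (lr_product H S) (u, e)" by fact
  have const: "(\<lambda>i\<in>idx S a. p, a) \<in> carrier (lr_product H S)" if "a \<in> carrier (base S)" for a
    using that H by auto
  show ?thesis
  proof (rule groupI; simp only: with_unit_simps)
    show "e \<in> carrier (base S)" using P.one_closed by simp
    fix a assume a: "a \<in> carrier (base S)"
    show "sop (base S) e a = a" using P.l_one[unfolded with_unit_simps, OF const[OF a]] by simp
    obtain v where v: "v \<in> carrier (lr_product H S)"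
      "sop (lr_product H S) v (\<lambda>i\<in>idx S a. p, a) = (u, e)"
      using P.l_inv_ex[unfolded with_unit_simps, OF const[OF a]] by blast
    then obtain y b where "v = (y, b)" by (cases v)
    with v show "\<exists>b\<in>carrier (base S). sop (base S) b a = e" by auto
  qed (use base_semigroup in \<open>auto simp: is_semigroup_def\<close>)
qed

lemma unital_of_lr_product_monoid:
  assumes "lr_system S"
    and H: "monoid (with_unit H p)" "q \<in> carrier H" "p \<noteq> q"
    and G: "monoid (with_unit (base S) e)"
    and P: "monoid (with_unit (lr_product H S) (u, e))"
    and a: "a \<in> carrier (base S)" and i: "i \<in> idx S a"
  shows "lam S a e i = i \<and> rho S e a i = i"
proof -
  interpret lr_system S by fact
  interpret H: monoid "with_unit H p" by fact
  interpret G: monoid "with_unit (base S) e" by fact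
  interpret P: monoid "with_unit (lr_product H S) (u, e)" by fact
  have p: "p \<in> carrier H" using H.one_closed by simp
  have e: "e \<in> carrier (base S)" and ea: "sop (base S) e a = a" "sop (base S) a e = a"
    using G.one_closed G.l_one[of a] G.r_one[of a] a by simp_all
  have mem: "lam S e a i \<in> idx S e" "rho S e a i \<in> idx S a"
    "lam S a e i \<in> idx S a" "rho S a e i \<in> idx S e"
    using lam_maps[OF e a] rho_maps[OF e a] lam_maps[OF a e] rho_maps[OF a e] i
    by (auto simp: ea)
  have uH: "u j \<in> carrier H" if "j \<in> idx S e" for j
    using P.one_closed that by auto
  have l: "sop H (u (lam S e a i)) (x (rho S e a i)) = x i"
    and r: "sop H (x (lam S a e i)) (u (rho S a e i)) = x i"
    if "x \<in> idx S a \<rightarrow>\<^sub>E carrier H" for x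
  proof -
    have "(x, a) \<in> carrier (lr_product H S)" using that a by simp
    then have "sop (lr_product H S) (u, e) (x, a) = (x, a)"
      "sop (lr_product H S) (x, a) (u, e) = (x, a)"
      by (fact P.l_one[unfolded with_unit_simps] P.r_one[unfolded with_unit_simps])+
    then have "(\<lambda>i\<in>idx S a. sop H (u (lam S e a i)) (x (rho S e a i))) = x"
      "(\<lambda>i\<in>idx S a. sop H (x (lam S a e i)) (u (rho S a e i))) = x"
      by (simp_all add: ea)
    from fun_cong[OF this(1), of i] fun_cong[OF this(2), of i] i
    show "sop H (u (lam S e a i)) (x (rho S e a i)) = x i"
      "sop H (x (lam S a e i)) (u (rho S a e i)) = x i" by simp_all
  qed
  have pH: "(\<lambda>j\<in>idx S a. p) \<in> idx S a \<rightarrow>\<^sub>E carrier H" using p by auto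
  \<comment> \<open>The constant function \<open>p\<close> turns \<open>l\<close> and
    \<open>r\<close> into equations between a value of \<open>u\<close> times \<open>p\<close> and
    \<open>p\<close>, where \<open>p\<close> is the unit of \<open>H\<close>.\<close>
  have u: "u (lam S e a i) = p" "u (rho S a e i) = p"
    using l[OF pH] r[OF pH] mem i H.r_one[of "u (lam S e a i)"] H.l_one[of "u (rho S a e i)"] uH
    by simp_all
  \<comment> \<open>The indicator function of \<open>i\<close>: among points of
    \<open>idx S a\<close> it takes the value \<open>q\<close> at \<open>i\<close> only.\<close>
  let ?d = "\<lambda>j\<in>idx S a. if j = i then q else p"
  have d: "?d \<in> idx S a \<rightarrow>\<^sub>E carrier H" using p H(2) by auto
  have "?d j \<in> carrier H" if "j \<in> idx S a" for j using d that by (rule PiE_mem)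
  then have "?d (rho S e a i) = ?d i" "?d (lam S a e i) = ?d i"
    using l[OF d] r[OF d] H.l_one[of "?d (rho S e a i)"] H.r_one[of "?d (lam S a e i)"] mem u
    by simp_all
  then show ?thesis using mem i H(3) by (auto split: if_splits)
qed

section \<open>Unital systems over a group\<close>

locale unital_lr_group = lr_system S + G: group "with_unit (base S) e"
  for S :: "('a, 'i) lr_data" and e +
  assumes lam_one: "\<lbrakk>a \<in> carrier (base S); i \<in> idx S a\<rbrakk> \<Longrightarrow> lam S a e i = i"
    and rho_one: "\<lbrakk>a \<in> carrier (base S); i \<in> idx S a\<rbrakk> \<Longrightarrow> rho S e a i = i"
begin

abbreviation op (infixl "\<cdot>" 70) where "a \<cdot> b \<equiv> sop (base S) a b"
abbreviation C where "C \<equiv> carrier (base S)"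
abbreviation inverse_of where "inverse_of a \<equiv> m_inv (with_unit (base S) e) a"

lemmas group_laws [simp] =
  G.one_closed[unfolded with_unit_simps] G.inv_closed[unfolded with_unit_simps]
  G.m_closed[unfolded with_unit_simps] G.m_assoc[unfolded with_unit_simps]
  G.l_one[unfolded with_unit_simps] G.r_one[unfolded with_unit_simps]
  G.l_inv[unfolded with_unit_simps] G.r_inv[unfolded with_unit_simps]

lemma inverse_of_cancel [simp]:
  assumes "a \<in> C" "b \<in> C"
  shows "inverse_of a \<cdot> (a \<cdot> b) = b" "a \<cdot> (inverse_of a \<cdot> b) = b"
  using assms group_laws(4)[of "inverse_of a" a b] group_laws(4)[of a "inverse_of a" b]
  by (simp_all del: group_laws(4))

lemma lam_closed: "\<lbrakk>a \<in> C; b \<in> C; i \<in> idx S (a \<cdot> b)\<rbrakk> \<Longrightarrow> lam S a b i \<in> idx S a"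
  and rho_closed: "\<lbrakk>a \<in> C; b \<in> C; i \<in> idx S (a \<cdot> b)\<rbrakk> \<Longrightarrow> rho S a b i \<in> idx S b"
  using lam_maps rho_maps by blast+

text \<open>By (\<alpha>) the two composites collapse to \<open>lam S (a \<cdot> b) e\<close> and
  \<open>lam S a e\<close>, which are identities by unitality.\<close>

lemma lam_inverse:
  assumes "a \<in> C" "b \<in> C"
  shows "i \<in> idx S (a \<cdot> b) \<Longrightarrow> lam S (a \<cdot> b) (inverse_of b) (lam S a b i) = i"
    and "i \<in> idx S a \<Longrightarrow> lam S a b (lam S (a \<cdot> b) (inverse_of b) i) = i"
  using assms alpha[of "a \<cdot> b" "inverse_of b" b i] alpha[of a b "inverse_of b" i]
  by (simp_all add: lam_one)

lemma is_group_lr_product: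
  assumes "is_group H"
  shows "is_group (lr_product H S)"
proof -
  obtain h where "group (with_unit H h)" using assms by (auto simp: is_group_def)
  then interpret H: group "with_unit H h" .
  have Hs: "is_semigroup H"
    using H.m_closed H.m_assoc by (simp add: is_semigroup_def)
  have h: "h \<in> carrier H" using H.one_closed by simp
  let ?P = "lr_product H S" and ?u = "(\<lambda>i\<in>idx S e. h, e)"
  have "group (with_unit ?P ?u)"
  proof (rule groupI; simp only: with_unit_simps(2,3) with_unit_simps(1)[of ?P])
    show "?u \<in> carrier ?P" using h by auto
    fix v assume v: "v \<in> carrier ?P"
    then obtain x a where xa: "v = (x, a)" "a \<in> C" "x \<in> idx S a \<rightarrow>\<^sub>E carrier H" by auto
    have xH: "x i \<in> carrier H" if "i \<in> idx S a" for i using xa(3) that by auto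
    have "sop H h (x i) = x i" if "i \<in> idx S a" for i
      using H.l_one xH[OF that] by simp
    then show "sop ?P ?u v = v"
      \<comment> \<open>Off \<open>idx S a\<close> both functions are \<open>undefined\<close>, by
        \<open>PiE_arb\<close>.\<close>
      using xa lam_closed[of e a] PiE_arb[OF xa(3)]
      by (auto simp: rho_one intro!: ext)
    let ?a' = "inverse_of a"
    \<comment> \<open>A left inverse must satisfy
      \<open>y (lam S ?a' a i) = (x (rho S ?a' a i))\<close> inverted, for \<open>i\<close> in
      \<open>idx S e\<close>. Substituting \<open>i = lam S e ?a' j\<close> solves this for
      \<open>y j\<close>.\<close>
    let ?y = "\<lambda>j\<in>idx S ?a'. m_inv (with_unit H h) (x (rho S ?a' a (lam S e ?a' j)))"
    have rH: "x (rho S ?a' a i) \<in> carrier H" if "i \<in> idx S e" for i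
      using that xa by (intro xH rho_closed) simp_all
    have "m_inv (with_unit H h) (x (rho S ?a' a (lam S e ?a' j))) \<in> carrier H"
      if "j \<in> idx S ?a'" for j
      using that xa H.inv_closed rH[OF lam_closed[of e ?a' j]] by simp
    then have yP: "(?y, ?a') \<in> carrier ?P" using xa by auto
    have "lam S ?a' a i \<in> idx S ?a'" "lam S e ?a' (lam S ?a' a i) = i" if "i \<in> idx S e" for i
      using that xa lam_closed[of ?a' a i] lam_inverse(1)[of ?a' a i]
        alpha[of e ?a' a i] by (simp_all add: lam_one)
    then have "sop ?P (?y, ?a') v = ?u"
      using xa H.l_inv rH by (auto intro!: restrict_ext)
    with yP show "\<exists>w\<in>carrier ?P. sop ?P w v = ?u" by blast
  qed (use is_semigroup_lr_product[OF Hs, unfolded is_semigroup_def] in \<open>blast+\<close>)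
  then show ?thesis unfolding is_group_def by blast
qed

text \<open>The map \<open>rho S a (inverse_of a)\<close> leads from \<open>idx S e\<close> to
  \<open>idx S (inverse_of a)\<close>, as \<open>e\<close> is the product of \<open>a\<close> and
  its inverse; the bijection \<open>lam\<close> leads back.\<close>

definition induced_action :: "'i \<Rightarrow> 'a \<Rightarrow> 'i" where
  "induced_action x a = lam S e (inverse_of a) (rho S a (inverse_of a) x)"

text \<open>Under the identifications \<open>lam S e\<close>, acting by \<open>a\<close> becomes
  \<open>rho S a b\<close>: (\<gamma>) moves \<open>rho\<close> inside \<open>lam\<close>, and
  (\<alpha>) merges the two remaining \<open>lam\<close>.\<close>

lemma induced_action_lam:
  assumes "a \<in> C" "b \<in> C" "i \<in> idx S (a \<cdot> b)"
  shows "induced_action (lam S e (a \<cdot> b) i) a = lam S e b (rho S a b i)"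
  using assms gamma[of a "inverse_of a" "a \<cdot> b" i] rho_closed[of a b i]
    alpha[of e "inverse_of a" "a \<cdot> b" "rho S a b i"]
  by (simp add: induced_action_def)

lemma right_action_induced_action: "right_action (base S) (idx S e) induced_action"
  unfolding right_action_def
proof (intro exI[of _ e] conjI ballI)
  show "group (with_unit (base S) e)" by (rule G.group_axioms)
  fix x assume x: "x \<in> idx S e"
  show "induced_action x e = x"
    using x induced_action_lam[of e e x] by (simp add: lam_one rho_one)
  fix a assume a: "a \<in> C"
  show "induced_action x a \<in> idx S e"
    unfolding induced_action_def using a x by (intro lam_closed) (simp_all add: rho_closed)
  fix b assume b: "b \<in> C"
  \<comment> \<open>The lift of \<open>x\<close> along the bijection
    \<open>lam S e (a \<cdot> b)\<close>. On lifts the action is given by \<open>rho\<close>, and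
    (\<beta>) composes the two steps.\<close>
  define i where "i = lam S (a \<cdot> b) (inverse_of (a \<cdot> b)) x"
  have i: "i \<in> idx S (a \<cdot> b)" "lam S e (a \<cdot> b) i = x"
    using a b x lam_closed[of "a \<cdot> b" "inverse_of (a \<cdot> b)" x] lam_inverse(2)[of e "a \<cdot> b" x]
    unfolding i_def by (simp_all del: group_laws(4))
  have r: "rho S a b i \<in> idx S b" using a b i by (simp add: rho_closed)
  have "induced_action (induced_action x a) b = rho S b e (rho S a b i)"
    using induced_action_lam[of a b i] induced_action_lam[of b e "rho S a b i"]
      a b i r rho_closed[of b e] by (simp add: lam_one)
  also have "\<dots> = rho S (a \<cdot> b) e i"
    using beta[of a b e i] a b i by simp
  also have "\<dots> = induced_action x (a \<cdot> b)"
    using induced_action_lam[of "a \<cdot> b" e i] a b i rho_closed[of "a \<cdot> b" e i]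
    by (simp add: lam_one)
  finally show "induced_action (induced_action x a) b = induced_action x (a \<cdot> b)" .
qed

text \<open>The bijections \<open>lam S e a\<close> commute with \<open>lam\<close> by (\<alpha>)
  and with \<open>rho\<close> by \<open>induced_action_lam\<close>.\<close>

lemma lr_iso_induced_action: "lr_iso S (action_system (idx S e) induced_action (base S))"
  unfolding lr_iso_def transformation_def
proof (intro exI[of _ "lam S e"] exI[of _ id] conjI ballI)
  fix a b i
  assume "a \<in> carrier (base (action_system (idx S e) induced_action (base S)))"
    "b \<in> carrier (base (action_system (idx S e) induced_action (base S)))"
    "i \<in> idx S (id (sop (base (action_system (idx S e) induced_action (base S))) a b))"
  then show "lam (action_system (idx S e) induced_action (base S)) a b
        (lam S e (sop (base (action_system (idx S e) induced_action (base S))) a b) i)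
      = lam S e a (lam S (id a) (id b) i)"
    and "rho (action_system (idx S e) induced_action (base S)) a b
        (lam S e (sop (base (action_system (idx S e) induced_action (base S))) a b) i)
      = lam S e b (rho S (id a) (id b) i)"
    using alpha[of e a b i] by (simp_all add: action_system_def induced_action_lam)
next
  fix a assume "a \<in> carrier (base (action_system (idx S e) induced_action (base S)))"
  then have "bij_betw (lam S e a) (idx S a) (idx S e)"
    using lam_inverse[of e a] lam_closed[of e a] lam_closed[of a "inverse_of a"]
    by (intro bij_betw_byWitness[where f' = "lam S a (inverse_of a)"])
      (auto simp: action_system_def)
  then show "bij_betw (lam S e a) (idx S (id a))
      (idx (action_system (idx S e) induced_action (base S)) a)"
    by (simp add: action_system_def)
qed (auto simp: action_system_def lam_closed)

end

text \<open>\<open>is_group\<close> and \<open>unital\<close> each assert a unit of their own;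
  uniqueness merges the two.\<close>

lemma unital_lr_groupI:
  assumes "lr_system S" "is_group (base S)" "unital S"
  obtains e where "unital_lr_group S e"
proof -
  obtain e where e: "monoid (with_unit (base S) e)"
    "\<forall>a\<in>carrier (base S). \<forall>i\<in>idx S a. lam S a e i = i \<and> rho S e a i = i"
    using assms(3) by (auto simp: unital_def)
  obtain e' where e': "group (with_unit (base S) e')"
    using assms(2) by (auto simp: is_group_def)
  have "e = e'" using e(1) group.is_monoid[OF e'] by (rule with_unit_one_unique)
  then show thesis
    using that[of e] assms(1) e e' by (simp add: unital_lr_group_def unital_lr_group_axioms_def)
qed

section \<open>Transport of unitality along an isomorphism\<close>

lemma unital_of_lr_iso_action_system:
  assumes "lr_system S"
    and act: "right_action (base S) X act"
    and iso: "lr_iso S (action_system X act (base S))"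
  shows "unital S"
proof -
  interpret lr_system S by fact
  obtain e where "group (with_unit (base S) e)" and e: "\<And>x. x \<in> X \<Longrightarrow> act x e = x"
    using act by (auto simp: right_action_def)
  then interpret G: group "with_unit (base S) e" by simp
  let ?C = "carrier (base S)"
  have eC: "e \<in> ?C" and l: "\<And>a. a \<in> ?C \<Longrightarrow> sop (base S) e a = a"
    and r: "\<And>a. a \<in> ?C \<Longrightarrow> sop (base S) a e = a"
    using G.one_closed G.l_one G.r_one by simp_all
  obtain t h where T: "transformation S (action_system X act (base S)) t h"
    and h: "bij_betw h ?C ?C" and t: "\<And>a. a \<in> ?C \<Longrightarrow> bij_betw (t a) (idx S (h a)) X"
    using iso by (auto simp: lr_iso_def action_system_def)
  have hom: "h (sop (base S) a b) = sop (base S) (h a) (h b)"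
    if "a \<in> ?C" "b \<in> ?C" for a b
    using T that by (simp add: transformation_def action_system_def)
  have tl: "t (sop (base S) a b) i = t a (lam S (h a) (h b) i)"
    and tr: "act (t (sop (base S) a b) i) a = t b (rho S (h a) (h b) i)"
    if "a \<in> ?C" "b \<in> ?C" "i \<in> idx S (h (sop (base S) a b))" for a b i
    using T that unfolding transformation_def action_system_def lr_data.simps by blast+
  have hC: "h a \<in> ?C" if "a \<in> ?C" for a using h that by (rule bij_betw_apply)
  \<comment> \<open>The image of \<open>e\<close> is idempotent, and a group has no other idempotent
    than its unit.\<close>
  have he: "h e = e"
    using G.l_cancel_one[of "h e" "h e"] hom[of e e] eC hC[of e] by (simp add: l)
  have inj: "i = j" if "a \<in> ?C" "i \<in> idx S (h a)" "j \<in> idx S (h a)" "t a i = t a j" for a i j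
    using bij_betw_imp_inj_on[OF t[OF that(1)]] that(2-4) by (auto dest: inj_onD)
  \<comment> \<open>The transformation only controls structure maps at values of \<open>h\<close>;
    surjectivity of \<open>h\<close> then covers the whole base. Both identities are checked after
    applying the injective \<open>t a\<close>.\<close>
  have "lam S (h a) e i = i \<and> rho S e (h a) i = i" if a: "a \<in> ?C" and i: "i \<in> idx S (h a)" for a i
  proof
    show "lam S (h a) e i = i"
      using tl[of a e i] lam_maps[of "h a" e] a eC i hC[OF a] he
      by (intro inj[OF a]) (auto simp: r)
    have "act (t a i) e = t a i" using e bij_betw_apply[OF t[OF a] i] .
    then show "rho S e (h a) i = i"
      using tr[of e a i] rho_maps[of e "h a"] a eC i hC[OF a] he
      by (intro inj[OF a]) (auto simp: l)
  qed
  moreover have "\<exists>a'\<in>?C. a = h a'" if "a \<in> ?C" for a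
    using h that by (auto simp: bij_betw_def)
  ultimately show ?thesis
    unfolding unital_def using G.is_monoid by blast
qed

theorem theorem5:
  fixes S :: "('a, 'i) lr_data"
  assumes "lr_system S"
    and "\<exists>x y :: 'h. x \<noteq> y"
  shows "(group_preserving TYPE('h) S \<longleftrightarrow> is_group (base S) \<and> unital S) \<and>
    (is_group (base S) \<and> unital S \<longleftrightarrow>
      is_group (base S) \<and>
      (\<exists>(X :: 'i set) act. right_action (base S) X act \<and>
        lr_iso S (action_system X act (base S))))"
proof -
  have "is_group (base S) \<and> unital S" if P: "group_preserving TYPE('h) S"
  proof -
    obtain p q :: 'h where pq: "p \<noteq> q" using assms(2) by blast
    let ?H = "\<lparr>carrier = {p, q}, sop = \<lambda>x y. if x = y then p else q\<rparr>"
    have H: "group (with_unit ?H p)" using pq by (rule group_two_elements)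
    then have "is_group (lr_product ?H S)"
      using P by (auto simp: group_preserving_def is_group_def)
    then obtain u e where ue: "group (with_unit (lr_product ?H S) (u, e))"
      by (auto simp: is_group_def)
    have G: "group (with_unit (base S) e)"
      by (rule base_group_of_lr_product_group[OF assms(1) _ ue, of p]) simp
    show ?thesis
      using unital_of_lr_product_monoid[OF assms(1) group.is_monoid[OF H] _ pq group.is_monoid[OF G]
          group.is_monoid[OF ue]] G group.is_monoid[OF G]
      unfolding is_group_def unital_def by auto
  qed
  moreover have "group_preserving TYPE('h) S" if "is_group (base S)" "unital S"
    using assms(1) that
    by (rule unital_lr_groupI) (simp add: group_preserving_def unital_lr_group.is_group_lr_product)
  moreover have "\<exists>(X :: 'i set) act. right_action (base S) X act \<and>
      lr_iso S (action_system X act (base S))" if "is_group (base S)" "unital S"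
    using assms(1) that
    by (rule unital_lr_groupI)
      (blast intro: unital_lr_group.right_action_induced_action unital_lr_group.lr_iso_induced_action)
  ultimately show ?thesis
    using unital_of_lr_iso_action_system[OF assms(1)] by blast
qed

end
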